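(* Let $\Omega=(0,1)^d$, let $s>0$ and $t\ge s$, let $\sigma(x)=\mathrm{ReLU}^s(x)$ and $\varphi(x)=1+\mathrm{ReLU}^t(x)$. Then $B_{\mathrm{ReLU}^s(x)}^{1+\mathrm{ReLU}^t(x)}=B^s$ as sets of functions on $\Omega$, and $$\tfrac12\,\|f\|_{B_{\mathrm{ReLU}^s(x)}^{1+\mathrm{ReLU}^t(x)}}\le\|f\|_{B^s}\le\|f\|_{B_{\mathrm{ReLU}^s(x)}^{1+\mathrm{ReLU}^t(x)}}$$ for every $f$ in this space.
   Context: $\mathrm{ReLU}(x)=\max(0,x)$ and $\mathrm{ReLU}^s(x)=(\max(0,x))^s$. Points of $\mathbb{R}^{d+1}$ are written $(w,b)$ with $w\in\mathbb{R}^d$, $b\in\mathbb{R}$; $|\rho|$ denotes total variation. Functions and measures are real-valued: $\mathcal{M}(\mathbb{R}^{d+1})$ is the space of finite signed Radon measures on $\mathbb{R}^{d+1}$. Functions on $\Omega$ are identified when they agree almost everywhere. Extended Barron space $B^s$: the set of functions $f$ on $\Omega$ for which there is $\rho\in\mathcal{M}(\mathbb{R}^{d+1})$ with $f(x)=\int_{\mathbb{R}^{d+1}}\mathrm{ReLU}^s(w\cdot x+b)\,\mathrm{d}\rho(w,b)$ on $\Omega$ and $\int_{\mathbb{R}^{d+1}}\mathrm{ReLU}^s(\|w\|_1+|b|)\,\mathrm{d}|\rho|<\infty$; $\|f\|_{B^s}$ is the infimum of the latter integral over all such $\rho$. Generalized Barron space $B_\sigma^\varphi=B_\sigma^\varphi(\Omega)$: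 the set of measurable functions $f$ on $\Omega$ for which there is $\rho\in\mathcal{M}(\mathbb{R}^{d+1})$ with $f(x)=\int_{\mathbb{R}^{d+1}}\sigma(w\cdot x+b)\,\mathrm{d}\rho(w,b)$ for a.e. $x\in\Omega$ and $\int_{\mathbb{R}^{d+1}}\varphi(\|w\|_1+|b|)\,\mathrm{d}|\rho|<\infty$; $\|f\|_{B_\sigma^\varphi}$ is the infimum of the latter integral over all such $\rho$. *)

theory Defs
  imports "HOL-Analysis.Analysis"
begin

section \<open>Finite signed Borel measures\<close>

text \<open>A finite signed measure is a real-valued, countably additive set function on the Borel sets;
  its values on non-Borel sets are irrelevant. On a Euclidean space every finite Borel measure is
  regular, so these are exactly the finite signed Radon measures.\<close>

definition signed_borel_measure :: "('a::topological_space set \<Rightarrow> real) \<Rightarrow> bool" where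
  "signed_borel_measure \<rho> \<longleftrightarrow>
     \<rho> {} = 0 \<and>
     (\<forall>A :: nat \<Rightarrow> 'a set. range A \<subseteq> sets borel \<longrightarrow> disjoint_family A \<longrightarrow>
        (\<lambda>n. \<rho> (A n)) sums \<rho> (\<Union>n. A n))"

definition total_variation :: "('a::topological_space set \<Rightarrow> real) \<Rightarrow> 'a measure" where
  "total_variation \<rho> = measure_of UNIV (sets borel)
     (\<lambda>A. SUP P \<in> {P. finite P \<and> partition_on A P \<and> P \<subseteq> sets borel}. \<Sum>B\<in>P. ennreal \<bar>\<rho> B\<bar>)"

text \<open>The Jordan decomposition: the positive and negative parts
  are half of the total variation plus, respectively minus, the signed measure itself.\<close>

definition positive_part :: "('a::topological_space set \<Rightarrow> real) \<Rightarrow> 'a measure" where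
  "positive_part \<rho> = measure_of UNIV (sets borel)
     (\<lambda>A. ennreal ((measure (total_variation \<rho>) A + \<rho> A) / 2))"

definition negative_part :: "('a::topological_space set \<Rightarrow> real) \<Rightarrow> 'a measure" where
  "negative_part \<rho> = measure_of UNIV (sets borel)
     (\<lambda>A. ennreal ((measure (total_variation \<rho>) A - \<rho> A) / 2))"

text \<open>Integrability is part of the notion, since a Bochner integral that does not exist is 0.\<close>

definition has_signed_integral ::
    "('a::topological_space \<Rightarrow> real) \<Rightarrow> real \<Rightarrow> ('a set \<Rightarrow> real) \<Rightarrow> bool" where
  "has_signed_integral g v \<rho> \<longleftrightarrow>
     integrable (total_variation \<rho>) g \<and>
     v = (\<integral>z. g z \<partial>positive_part \<rho>) - (\<integral>z. g z \<partial>negative_part \<rho>)"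


section \<open>Barron spaces\<close>

definition relu_pow :: "real \<Rightarrow> real \<Rightarrow> real" where
  "relu_pow s x = (max 0 x) powr s"

definition norm_l1 :: "real ^ 'd \<Rightarrow> real" where
  "norm_l1 w = (\<Sum>i\<in>UNIV. \<bar>w $ i\<bar>)"

definition open_unit_cube :: "(real ^ 'd) set" where
  "open_unit_cube = {x. \<forall>i. 0 < x $ i \<and> x $ i < 1}"

text \<open>Functions on \<open>\<Omega>\<close> are total functions whose values outside \<open>\<Omega>\<close> play no role. As functions that
  agree almost everywhere on \<open>\<Omega>\<close> are identified, a representation on \<open>\<Omega>\<close> is one that
  holds for almost every point of \<open>\<Omega>\<close>, for both spaces below; all spaces are thus closed under
  almost-everywhere equality on \<open>\<Omega>\<close>.\<close>

definition barron_representations ::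
    "real \<Rightarrow> (real ^ 'd) set \<Rightarrow> (real ^ 'd \<Rightarrow> real) \<Rightarrow> (((real ^ 'd) \<times> real) set \<Rightarrow> real) set" where
  "barron_representations s \<Omega> f = {\<rho>. signed_borel_measure \<rho> \<and>
     (AE x in lebesgue_on \<Omega>. has_signed_integral (\<lambda>(w, b). relu_pow s (w \<bullet> x + b)) (f x) \<rho>) \<and>
     integrable (total_variation \<rho>) (\<lambda>(w, b). relu_pow s (norm_l1 w + \<bar>b\<bar>))}"

definition barron_space :: "real \<Rightarrow> (real ^ 'd) set \<Rightarrow> (real ^ 'd \<Rightarrow> real) set" where
  "barron_space s \<Omega> = {f. barron_representations s \<Omega> f \<noteq> {}}"

definition barron_norm :: "real \<Rightarrow> (real ^ 'd) set \<Rightarrow> (real ^ 'd \<Rightarrow> real) \<Rightarrow> real" where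
  "barron_norm s \<Omega> f =
     (INF \<rho> \<in> barron_representations s \<Omega> f.
        \<integral>(w, b). relu_pow s (norm_l1 w + \<bar>b\<bar>) \<partial>total_variation \<rho>)"

text \<open>The weight \<open>\<phi>\<close> is meant to be nonnegative, so that integrability expresses that the weighted
  total variation is finite. Measurability on \<open>\<Omega>\<close> is Lebesgue measurability, which is invariant under
  almost-everywhere equality.\<close>

definition gen_barron_representations ::
    "(real \<Rightarrow> real) \<Rightarrow> (real \<Rightarrow> real) \<Rightarrow> (real ^ 'd) set \<Rightarrow> (real ^ 'd \<Rightarrow> real) \<Rightarrow>
     (((real ^ 'd) \<times> real) set \<Rightarrow> real) set" where
  "gen_barron_representations \<sigma> \<phi> \<Omega> f = {\<rho>. signed_borel_measure \<rho> \<and>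
     (AE x in lebesgue_on \<Omega>. has_signed_integral (\<lambda>(w, b). \<sigma> (w \<bullet> x + b)) (f x) \<rho>) \<and>
     integrable (total_variation \<rho>) (\<lambda>(w, b). \<phi> (norm_l1 w + \<bar>b\<bar>))}"

definition gen_barron_space ::
    "(real \<Rightarrow> real) \<Rightarrow> (real \<Rightarrow> real) \<Rightarrow> (real ^ 'd) set \<Rightarrow> (real ^ 'd \<Rightarrow> real) set" where
  "gen_barron_space \<sigma> \<phi> \<Omega> =
     {f \<in> borel_measurable (lebesgue_on \<Omega>). gen_barron_representations \<sigma> \<phi> \<Omega> f \<noteq> {}}"

definition gen_barron_norm ::
    "(real \<Rightarrow> real) \<Rightarrow> (real \<Rightarrow> real) \<Rightarrow> (real ^ 'd) set \<Rightarrow> (real ^ 'd \<Rightarrow> real) \<Rightarrow> real" where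
  "gen_barron_norm \<sigma> \<phi> \<Omega> f =
     (INF \<rho> \<in> gen_barron_representations \<sigma> \<phi> \<Omega> f.
        \<integral>(w, b). \<phi> (norm_l1 w + \<bar>b\<bar>) \<partial>total_variation \<rho>)"

end

theory Submission
  imports Defs
begin

text \<open>Write \<open>r = \<parallel>w\<parallel>\<^sub>1 + \<bar>b\<bar>\<close> for the weight of a point \<open>z = (w, b)\<close>. A neuron is positively homogeneous of
  degree \<open>s\<close> in \<open>z\<close>, so a representing measure can be moved to the sphere \<open>r = 1\<close>: push the
  measure with density \<open>r\<^sup>s\<close> forward under \<open>z \<mapsto> z / r\<close>. The represented function does not change,
  the total mass becomes at most \<open>\<integral> r\<^sup>s d|\<rho>|\<close>, and on the sphere \<open>1 + r\<^sup>t = 2\<close>. This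
  yields the factor 2 (\<open>gen_barron_representation_of_barron\<close>). Conversely \<open>r\<^sup>s \<le> 1 + r\<^sup>t\<close> because
  \<open>s \<le> t\<close>, so every representing measure for the generalized space serves unchanged for \<open>B\<^sup>s\<close>
  (\<open>barron_representation_of_gen_barron\<close>). Measurability of the members of \<open>B\<^sup>s\<close> is a
  consequence of Fubini's theorem (\<open>borel_measurable_barron\<close>).

  The push-forward is carried out on the two Jordan parts separately, and the new signed measure is
  the difference of two finite measures \<open>P\<close> and \<open>N\<close>. Integrating against a difference requires some
  signed measure theory: the total variation of a signed measure is a finite
  measure (\<open>variation_countably_additive\<close>, \<open>signed_measure_bounded\<close>), it is the sum of the Jordan parts,
  it is at most \<open>P + N\<close> for any representation \<open>P - N\<close> (\<open>total_variation_diff_le\<close>), and the signed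
  integral may be computed with \<open>P\<close> and \<open>N\<close> (\<open>has_signed_integral_diff\<close>).\<close>

section \<open>Signed measures and their total variation\<close>

lemma signed_measure_sums:
  assumes "signed_borel_measure \<rho>" "range A \<subseteq> sets borel" "disjoint_family (A :: nat \<Rightarrow> _)"
  shows "(\<lambda>n. \<rho> (A n)) sums \<rho> (\<Union>n. A n)"
  using assms unfolding signed_borel_measure_def by blast

lemma signed_measure_empty [simp]: "signed_borel_measure \<rho> \<Longrightarrow> \<rho> {} = 0"
  unfolding signed_borel_measure_def by blast

lemma signed_measure_Un:
  assumes \<rho>: "signed_borel_measure \<rho>" and "A \<in> sets borel" "B \<in> sets borel" "A \<inter> B = {}"
  shows "\<rho> (A \<union> B) = \<rho> A + \<rho> B"
proof -
  have "(\<lambda>n. \<rho> (binaryset A B n)) sums \<rho> (\<Union>n. binaryset A B n)"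
    using assms by (intro signed_measure_sums)
      (auto simp: disjoint_family_on_def binaryset_def range_binaryset_eq)
  moreover have "(\<lambda>n. \<rho> (binaryset A B n)) sums (\<rho> A + \<rho> B)"
    using \<rho> by (intro binaryset_sums) auto
  ultimately show ?thesis
    by (metis UN_binaryset_eq sums_unique2)
qed

lemma signed_measure_Diff:
  assumes "signed_borel_measure \<rho>" "A \<in> sets borel" "B \<in> sets borel" "B \<subseteq> A"
  shows "\<rho> (A - B) = \<rho> A - \<rho> B"
  using signed_measure_Un[of \<rho> B "A - B"] assms by (auto simp: Un_absorb1)

lemma signed_measure_UN_finite:
  assumes \<rho>: "signed_borel_measure \<rho>" and "finite I"
    and "disjoint_family_on B I" "\<And>i. i \<in> I \<Longrightarrow> B i \<in> sets borel"
  shows "\<rho> (\<Union>i\<in>I. B i) = (\<Sum>i\<in>I. \<rho> (B i))"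
  using assms(2-)
proof (induction I rule: finite_induct)
  case (insert i I)
  have "\<rho> (B i \<union> (\<Union>j\<in>I. B j)) = \<rho> (B i) + \<rho> (\<Union>j\<in>I. B j)"
    using insert.prems insert.hyps
    by (intro signed_measure_Un[OF \<rho>] sets.finite_UN) (auto simp: disjoint_family_on_def)
  moreover have "disjoint_family_on B I"
    using insert.prems by (auto simp: disjoint_family_on_def)
  ultimately show ?case
    using insert by simp
qed (use \<rho> in simp)

text \<open>If the values on subsets of \<open>E\<close> are unbounded, some \<open>B \<subseteq> E\<close> splits \<open>E\<close> into two pieces of
  value larger than 1 in modulus, and the values are still unbounded on one of the two.
  Discarding the other piece and repeating gives disjoint sets whose values do not tend to 0,
  which contradicts countable additivity.\<close>

lemma signed_measure_bounded:
  fixes \<rho> :: "'a::topological_space set \<Rightarrow> real"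
  assumes \<rho>: "signed_borel_measure \<rho>"
  obtains K where "\<And>A. A \<in> sets borel \<Longrightarrow> \<bar>\<rho> A\<bar> \<le> K"
proof -
  define Unb where "Unb E \<longleftrightarrow> E \<in> sets borel \<and> (\<forall>K. \<exists>B\<in>sets borel. B \<subseteq> E \<and> \<bar>\<rho> B\<bar> > K)" for E
  have split: "\<exists>F. Unb F \<and> F \<subseteq> E \<and> \<bar>\<rho> (E - F)\<bar> > 1" if E: "Unb E" for E
  proof -
    obtain B where B: "B \<in> sets borel" "B \<subseteq> E" "\<bar>\<rho> B\<bar> > \<bar>\<rho> E\<bar> + 1"
      using E unfolding Unb_def by blast
    have Eb: "E \<in> sets borel" using E unfolding Unb_def by blast
    have dB: "\<rho> (E - B) = \<rho> E - \<rho> B"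
      using signed_measure_Diff[OF \<rho>] B Eb by blast
    have "E - (E - B) = B" using B by blast
    then have big: "\<bar>\<rho> (E - (E - B))\<bar> > 1" "\<bar>\<rho> (E - B)\<bar> > 1"
      using B(3) dB by auto
    have "Unb B \<or> Unb (E - B)"
    proof (rule ccontr)
      assume "\<not> (Unb B \<or> Unb (E - B))"
      then obtain K L where
        K: "\<And>C. C \<in> sets borel \<Longrightarrow> C \<subseteq> B \<Longrightarrow> \<bar>\<rho> C\<bar> \<le> K" and
        L: "\<And>C. C \<in> sets borel \<Longrightarrow> C \<subseteq> E - B \<Longrightarrow> \<bar>\<rho> C\<bar> \<le> L"
        using B(1) Eb unfolding Unb_def by (meson not_less sets.Diff)
      have "\<bar>\<rho> C\<bar> \<le> K + L" if C: "C \<in> sets borel" "C \<subseteq> E" for C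
      proof -
        have "\<rho> ((C \<inter> B) \<union> (C - B)) = \<rho> (C \<inter> B) + \<rho> (C - B)"
          using C B by (intro signed_measure_Un[OF \<rho>]) auto
        moreover have "(C \<inter> B) \<union> (C - B) = C" by blast
        moreover have "\<bar>\<rho> (C \<inter> B)\<bar> \<le> K" using C B by (intro K) auto
        moreover have "\<bar>\<rho> (C - B)\<bar> \<le> L" using C B by (intro L) auto
        ultimately show ?thesis by auto
      qed
      then show False using E unfolding Unb_def by (meson not_less)
    qed
    then show ?thesis using big B by blast
  qed
  have "\<not> Unb UNIV"
  proof
    assume U: "Unb UNIV"
    have "\<exists>E. \<forall>n::nat. Unb (E n) \<and> (E (Suc n) \<subseteq> E n \<and> \<bar>\<rho> (E n - E (Suc n))\<bar> > 1)"
      by (rule dependent_nat_choice[where P = "\<lambda>_. Unb"]) (use U split in blast)+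
    then obtain E where E: "\<And>n::nat. Unb (E n)"
        "\<And>n. E (Suc n) \<subseteq> E n" "\<And>n. \<bar>\<rho> (E n - E (Suc n))\<bar> > 1"
      by blast
    have dec: "E n \<subseteq> E m" if "m \<le> n" for m n
      using lift_Suc_antimono_le[of E, OF E(2) that] .
    have "disjoint_family (\<lambda>n. E n - E (Suc n))"
      unfolding disjoint_family_on_def
    proof (intro ballI impI)
      fix m n :: nat assume "m \<noteq> n"
      then consider "Suc m \<le> n" | "Suc n \<le> m" by linarith
      then show "(E m - E (Suc m)) \<inter> (E n - E (Suc n)) = {}"
        by cases (use dec[of "Suc m" n] dec[of "Suc n" m] in blast)+
    qed
    moreover have "range (\<lambda>n. E n - E (Suc n)) \<subseteq> sets borel"
      using E(1) unfolding Unb_def by auto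
    ultimately have "(\<lambda>n. \<rho> (E n - E (Suc n))) sums \<rho> (\<Union>n. E n - E (Suc n))"
      by (intro signed_measure_sums[OF \<rho>])
    then have "(\<lambda>n. \<rho> (E n - E (Suc n))) \<longlonglongrightarrow> 0"
      using summable_LIMSEQ_zero sums_summable by blast
    then obtain n where "\<bar>\<rho> (E n - E (Suc n))\<bar> < 1"
      using LIMSEQ_D[of _ 0 1] by fastforce
    then show False using E(3)[of n] by simp
  qed
  then show thesis using that unfolding Unb_def by (auto simp: not_less)
qed

text \<open>The set function from which the total variation measure is generated, before it is known
  to be a measure.\<close>

definition variation :: "('a::topological_space set \<Rightarrow> real) \<Rightarrow> 'a set \<Rightarrow> ennreal" where
  "variation \<rho> A =
     (SUP P \<in> {P. finite P \<and> partition_on A P \<and> P \<subseteq> sets borel}. \<Sum>B\<in>P. ennreal \<bar>\<rho> B\<bar>)"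

text \<open>Families cut out of a partition can contain the empty set repeatedly, which partitions
  exclude, and need not cover \<open>A\<close>. Dropping empty members and adding the rest of \<open>A\<close> gives a
  partition.\<close>

lemma sum_le_variation:
  assumes \<rho>: "signed_borel_measure \<rho>" and A: "A \<in> sets borel"
    and I: "finite I" "disjoint_family_on B I"
    and B: "\<And>i. i \<in> I \<Longrightarrow> B i \<in> sets borel" "\<And>i. i \<in> I \<Longrightarrow> B i \<subseteq> A"
  shows "(\<Sum>i\<in>I. ennreal \<bar>\<rho> (B i)\<bar>) \<le> variation \<rho> A"
proof -
  define J where "J = {i \<in> I. B i \<noteq> {}}"
  define R where "R = A - (\<Union>i\<in>I. B i)"
  define P where "P = (B ` J \<union> {R}) - {{}}"
  have J: "finite J" "J \<subseteq> I" using I by (auto simp: J_def)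
  have dis: "B i \<inter> B j = {}" if "i \<in> I" "j \<in> I" "i \<noteq> j" for i j
    using I(2) that by (auto simp: disjoint_family_on_def)
  have inj: "inj_on B J"
    by (rule inj_onI) (use dis in \<open>fastforce simp: J_def\<close>)
  have "partition_on A P"
  proof (rule partition_onI)
    have "\<Union>P = (\<Union>i\<in>I. B i) \<union> R"
      unfolding P_def J_def by blast
    also have "\<dots> = A"
      unfolding R_def using B(2) by blast
    finally show "\<Union>P = A" .
    show "disjnt p q" if "p \<in> P" "q \<in> P" "p \<noteq> q" for p q
    proof -
      have 1: "B i \<inter> R = {}" if "i \<in> J" for i
        using that J unfolding R_def by blast
      have 2: "B i \<inter> B j = {}" if "i \<in> J" "j \<in> J" "B i \<noteq> B j" for i j
        using that dis[of i j] J by auto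
      have "p \<in> B ` J \<or> p = R" "q \<in> B ` J \<or> q = R"
        using that unfolding P_def by blast+
      then have "p \<inter> q = {}"
        using that(3) 1 2 by (elim disjE imageE) (simp_all add: Int_commute)
      then show ?thesis
        by (simp add: disjnt_def)
    qed
  qed (auto simp: P_def)
  moreover have "R \<in> sets borel"
    unfolding R_def using A B I by (intro sets.Diff sets.finite_UN) auto
  ultimately have P: "P \<in> {P. finite P \<and> partition_on A P \<and> P \<subseteq> sets borel}"
    using J B by (auto simp: P_def)
  have "(\<Sum>i\<in>I. ennreal \<bar>\<rho> (B i)\<bar>) = (\<Sum>i\<in>J. ennreal \<bar>\<rho> (B i)\<bar>)"
    using I \<rho> by (intro sum.mono_neutral_right) (auto simp: J_def)
  also have "\<dots> = (\<Sum>C\<in>B ` J. ennreal \<bar>\<rho> C\<bar>)"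
    using inj by (simp add: sum.reindex)
  also have "\<dots> \<le> (\<Sum>C\<in>P. ennreal \<bar>\<rho> C\<bar>)"
    using P by (intro sum_mono2) (auto simp: P_def J_def)
  also have "\<dots> \<le> variation \<rho> A"
    unfolding variation_def using P by (rule SUP_upper)
  finally show ?thesis .
qed

lemma abs_le_variation:
  assumes "signed_borel_measure \<rho>" "A \<in> sets borel"
  shows "ennreal \<bar>\<rho> A\<bar> \<le> variation \<rho> A"
  using sum_le_variation[OF assms, of "{A}" "\<lambda>x. x"] assms by (simp add: disjoint_family_on_def)

lemma variation_leI:
  assumes "\<And>P. finite P \<Longrightarrow> partition_on A P \<Longrightarrow> P \<subseteq> sets borel \<Longrightarrow> (\<Sum>B\<in>P. ennreal \<bar>\<rho> B\<bar>) \<le> c"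
  shows "variation \<rho> A \<le> c"
  unfolding variation_def using assms by (intro SUP_least) auto

text \<open>The pieces of nonnegative value and the pieces of negative value each have a union of value at
  most \<open>K\<close> in modulus; this is what makes the total variation finite.\<close>

lemma sum_abs_partition_le:
  assumes \<rho>: "signed_borel_measure \<rho>" and K: "\<And>A. A \<in> sets borel \<Longrightarrow> \<bar>\<rho> A\<bar> \<le> K"
    and P: "finite P" "partition_on A P" "P \<subseteq> sets borel"
  shows "(\<Sum>B\<in>P. \<bar>\<rho> B\<bar>) \<le> 2 * K"
proof -
  define Q where "Q = {B \<in> P. \<rho> B \<ge> 0}"
  have Q: "Q \<subseteq> P" "finite Q" using P by (auto simp: Q_def)
  have bnd: "\<bar>\<Sum>B\<in>S. \<rho> B\<bar> \<le> K" if "S \<subseteq> P" for S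
  proof -
    have S: "finite S" "disjoint_family_on (\<lambda>x. x) S" "S \<subseteq> sets borel"
      using that P finite_subset[OF that]
      by (auto simp: partition_on_def disjoint_family_on_def dest: disjointD)
    have "\<rho> (\<Union>B\<in>S. B) = (\<Sum>B\<in>S. \<rho> B)"
      using S by (intro signed_measure_UN_finite[OF \<rho>]) auto
    moreover have "(\<Union>B\<in>S. B) \<in> sets borel"
      using S by (intro sets.finite_UN) auto
    ultimately show ?thesis using K by metis
  qed
  have "(\<Sum>B\<in>P. \<bar>\<rho> B\<bar>) = (\<Sum>B\<in>P - Q. \<bar>\<rho> B\<bar>) + (\<Sum>B\<in>Q. \<bar>\<rho> B\<bar>)"
    using Q P by (intro sum.subset_diff)
  also have "\<dots> = - (\<Sum>B\<in>P - Q. \<rho> B) + (\<Sum>B\<in>Q. \<rho> B)"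
    unfolding sum_negf[symmetric] by (intro arg_cong2[where f="(+)"] sum.cong) (auto simp: Q_def)
  also have "\<dots> \<le> 2 * K"
    using bnd[of "P - Q"] bnd[of Q] Q by auto
  finally show ?thesis .
qed

lemma variation_finite:
  assumes \<rho>: "signed_borel_measure \<rho>"
  shows "variation \<rho> A < \<infinity>"
proof -
  obtain K where K: "\<And>A. A \<in> sets borel \<Longrightarrow> \<bar>\<rho> A\<bar> \<le> K"
    using signed_measure_bounded[OF \<rho>] by blast
  have "variation \<rho> A \<le> ennreal (2 * K)"
    using sum_abs_partition_le[OF \<rho> K] by (intro variation_leI) (simp add: ennreal_leI)
  then show ?thesis by (simp add: ennreal_less_top le_less_trans)
qed

text \<open>Partitions of disjoint sets combine to a disjoint family inside \<open>C\<close>.\<close>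

lemma variation_superadditive:
  assumes \<rho>: "signed_borel_measure \<rho>" and AB: "A \<in> sets borel" "B \<in> sets borel"
    and C: "C \<in> sets borel" "A \<subseteq> C" "B \<subseteq> C" "A \<inter> B = {}"
  shows "variation \<rho> A + variation \<rho> B \<le> variation \<rho> C"
proof -
  let ?S = "\<lambda>A. {P. finite P \<and> partition_on A P \<and> P \<subseteq> sets borel}"
  have le: "(\<Sum>B\<in>P. ennreal \<bar>\<rho> B\<bar>) + (\<Sum>B\<in>Q. ennreal \<bar>\<rho> B\<bar>) \<le> variation \<rho> C"
    if P: "P \<in> ?S A" and Q: "Q \<in> ?S B" for P Q
  proof -
    have "P \<inter> Q = {}"
    proof (rule ccontr)
      assume "P \<inter> Q \<noteq> {}"
      then obtain X where X: "X \<in> P" "X \<in> Q"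
        by blast
      then have "X \<subseteq> A \<inter> B" "X \<noteq> {}"
        using P Q by (auto simp: partition_on_def)
      then show False
        using C(4) by simp
    qed
    then have "(\<Sum>B\<in>P. ennreal \<bar>\<rho> B\<bar>) + (\<Sum>B\<in>Q. ennreal \<bar>\<rho> B\<bar>) = (\<Sum>B\<in>P \<union> Q. ennreal \<bar>\<rho> B\<bar>)"
      using P Q by (intro sum.union_disjoint[symmetric]) auto
    also have "\<dots> \<le> variation \<rho> C"
    proof (rule sum_le_variation[OF \<rho> C(1)])
      have "x \<inter> y = {}" if "x \<in> P \<union> Q" "y \<in> P \<union> Q" "x \<noteq> y" for x y
      proof -
        have un: "\<Union>P = A" "\<Union>Q = B" and dj: "disjoint P" "disjoint Q"
          using P Q by (auto simp: partition_on_def)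
        have "X \<inter> Y = {}" if "X \<in> P" "Y \<in> Q" for X Y
          using that C(4) un by blast
        then show ?thesis
          using \<open>x \<in> P \<union> Q\<close> \<open>y \<in> P \<union> Q\<close> \<open>x \<noteq> y\<close> disjointD[OF dj(1)] disjointD[OF dj(2)]
          by (metis Int_commute Un_iff)
      qed
      then show "disjoint_family_on (\<lambda>x. x) (P \<union> Q)"
        by (auto simp: disjoint_family_on_def)
    qed (use P Q C in \<open>auto simp: partition_on_def\<close>)
    finally show ?thesis .
  qed
  have "{X} - {{}} \<in> ?S X" if "X \<in> sets borel" for X
    using that by (auto simp: partition_on_def disjoint_def)
  then have ne: "?S A \<noteq> {}" "?S B \<noteq> {}"
    using AB by blast+
  have "variation \<rho> A + variation \<rho> B
      = (SUP P\<in>?S A. SUP Q\<in>?S B. (\<Sum>B\<in>P. ennreal \<bar>\<rho> B\<bar>) + (\<Sum>B\<in>Q. ennreal \<bar>\<rho> B\<bar>))"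
    unfolding variation_def
    by (simp only: ennreal_SUP_add_left[OF ne(1), symmetric] ennreal_SUP_add_right[OF ne(2), symmetric])
  also have "\<dots> \<le> variation \<rho> C"
    by (intro SUP_least le)
  finally show ?thesis .
qed

lemma sum_variation_le:
  assumes \<rho>: "signed_borel_measure \<rho>"
    and A: "range A \<subseteq> sets borel" "disjoint_family (A :: nat \<Rightarrow> _)"
  shows "(\<Sum>i<n. variation \<rho> (A i)) \<le> variation \<rho> (\<Union>i<n. A i)"
proof (induction n)
  case (Suc n)
  have Ab: "A i \<in> sets borel" for i
    using A by blast
  then have Ub: "(\<Union>i<m. A i) \<in> sets borel" for m
    by simp
  have "A i \<inter> A n = {}" if "i < n" for i
    using disjoint_family_onD[OF A(2), of i n] that by simp
  then have "(\<Union>i<n. A i) \<inter> A n = {}"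
    by blast
  note facts = this Ab Ub
  have "(\<Sum>i<Suc n. variation \<rho> (A i)) \<le> variation \<rho> (\<Union>i<n. A i) + variation \<rho> (A n)"
    using Suc by (simp add: add_right_mono)
  also have "\<dots> \<le> variation \<rho> (\<Union>i<Suc n. A i)"
    using facts by (intro variation_superadditive[OF \<rho>]) (auto simp: lessThan_Suc)
  finally show ?case .
qed simp

lemma abs_le_suminf_abs:
  assumes \<rho>: "signed_borel_measure \<rho>"
    and A: "range A \<subseteq> sets borel" "disjoint_family (A :: nat \<Rightarrow> _)"
  shows "ennreal \<bar>\<rho> (\<Union>i. A i)\<bar> \<le> (\<Sum>i. ennreal \<bar>\<rho> (A i)\<bar>)"
proof (rule LIMSEQ_le_const2)
  have "(\<lambda>n. \<Sum>i<n. \<rho> (A i)) \<longlonglongrightarrow> \<rho> (\<Union>i. A i)"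
    using signed_measure_sums[OF \<rho> A] by (simp add: sums_def)
  then show "(\<lambda>n. ennreal \<bar>\<Sum>i<n. \<rho> (A i)\<bar>) \<longlonglongrightarrow> ennreal \<bar>\<rho> (\<Union>i. A i)\<bar>"
    by (intro tendsto_ennrealI tendsto_rabs)
  have "ennreal \<bar>\<Sum>i<n. \<rho> (A i)\<bar> \<le> (\<Sum>i. ennreal \<bar>\<rho> (A i)\<bar>)" for n
  proof -
    have "ennreal \<bar>\<Sum>i<n. \<rho> (A i)\<bar> \<le> (\<Sum>i<n. ennreal \<bar>\<rho> (A i)\<bar>)"
      by (simp add: ennreal_leI sum_abs)
    also have "\<dots> \<le> (\<Sum>i. ennreal \<bar>\<rho> (A i)\<bar>)"
      by (intro sum_le_suminf) auto
    finally show ?thesis .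
  qed
  then show "\<exists>N. \<forall>n\<ge>N. ennreal \<bar>\<Sum>i<n. \<rho> (A i)\<bar> \<le> (\<Sum>i. ennreal \<bar>\<rho> (A i)\<bar>)"
    by blast
qed

text \<open>Superadditivity gives one inequality. For the other one, a partition of the union is cut along
  the \<open>A i\<close>: the cuts of one piece recover its value by countable additivity, and the cuts inside
  one \<open>A i\<close> are bounded by its variation.\<close>

lemma variation_countably_additive:
  assumes \<rho>: "signed_borel_measure (\<rho> :: 'a::topological_space set \<Rightarrow> real)"
  shows "countably_additive (sets borel) (variation \<rho>)"
  unfolding countably_additive_def
proof (intro allI impI antisym)
  fix A :: "nat \<Rightarrow> 'a set"
  assume A: "range A \<subseteq> sets borel" "disjoint_family A" and UA: "(\<Union>i. A i) \<in> sets borel"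
  have "(\<Sum>i<n. variation \<rho> (A i)) \<le> variation \<rho> (\<Union>i. A i)" for n
  proof -
    have "(\<Sum>i<n. variation \<rho> (A i)) \<le> variation \<rho> (\<Union>i<n. A i)"
      by (rule sum_variation_le[OF \<rho> A])
    also have "\<dots> \<le> variation \<rho> (\<Union>i<n. A i) + variation \<rho> {}"
      by simp
    also have "\<dots> \<le> variation \<rho> (\<Union>i. A i)"
    proof (intro variation_superadditive[OF \<rho>] UA)
      have "A i \<in> sets borel" for i
        using A by blast
      then show "(\<Union>i<n. A i) \<in> sets borel"
        by simp
    qed auto
    finally show ?thesis .
  qed
  then show "(\<Sum>i. variation \<rho> (A i)) \<le> variation \<rho> (\<Union>i. A i)"
    unfolding suminf_eq_SUP by (intro SUP_least)
  show "variation \<rho> (\<Union>i. A i) \<le> (\<Sum>i. variation \<rho> (A i))"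
  proof (rule variation_leI)
    fix P assume P: "finite P" "partition_on (\<Union>i. A i) P" "P \<subseteq> sets borel"
    have "(\<Sum>B\<in>P. ennreal \<bar>\<rho> B\<bar>) \<le> (\<Sum>B\<in>P. \<Sum>i. ennreal \<bar>\<rho> (B \<inter> A i)\<bar>)"
    proof (rule sum_mono)
      fix B assume B: "B \<in> P"
      have "B = (\<Union>i. B \<inter> A i)"
        using B P(2) by (auto simp: partition_on_def)
      moreover have "ennreal \<bar>\<rho> (\<Union>i. B \<inter> A i)\<bar> \<le> (\<Sum>i. ennreal \<bar>\<rho> (B \<inter> A i)\<bar>)"
        using A B P(3) by (intro abs_le_suminf_abs[OF \<rho>]) (auto simp: disjoint_family_on_def)
      ultimately show "ennreal \<bar>\<rho> B\<bar> \<le> (\<Sum>i. ennreal \<bar>\<rho> (B \<inter> A i)\<bar>)"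
        by simp
    qed
    also have "\<dots> = (\<Sum>i. \<Sum>B\<in>P. ennreal \<bar>\<rho> (B \<inter> A i)\<bar>)"
      by (intro suminf_sum[symmetric]) auto
    also have "\<dots> \<le> (\<Sum>i. variation \<rho> (A i))"
    proof (rule suminf_le)
      show "(\<Sum>B\<in>P. ennreal \<bar>\<rho> (B \<inter> A i)\<bar>) \<le> variation \<rho> (A i)" for i
      proof (rule sum_le_variation[OF \<rho>])
        have "disjoint P" using P(2) by (simp add: partition_on_def)
        then show "disjoint_family_on (\<lambda>B. B \<inter> A i) P"
          by (auto simp: disjoint_family_on_def dest: disjointD)
      qed (use A P in auto)
    qed auto
    finally show "(\<Sum>B\<in>P. ennreal \<bar>\<rho> B\<bar>) \<le> (\<Sum>i. variation \<rho> (A i))" .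
  qed
qed

lemma sets_total_variation [simp, measurable_cong]: "sets (total_variation \<rho>) = sets borel"
  unfolding total_variation_def using sets.sets_measure_of_eq[of borel] by simp

lemma space_total_variation [simp]: "space (total_variation \<rho>) = UNIV"
  unfolding total_variation_def by (simp add: space_measure_of_conv)

lemma emeasure_total_variation:
  assumes \<rho>: "signed_borel_measure \<rho>" and A: "A \<in> sets borel"
  shows "emeasure (total_variation \<rho>) A = variation \<rho> A"
proof (rule emeasure_measure_of[OF total_variation_def[of \<rho>, folded variation_def]])
  have "variation \<rho> {} \<le> 0"
    by (rule variation_leI) (simp add: partition_on_empty)
  then show "positive (sets (total_variation \<rho>)) (variation \<rho>)"
    by (simp add: positive_def)
qed (use A \<rho> in \<open>auto intro: variation_countably_additive\<close>)

lemma finite_measure_total_variation: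
  assumes "signed_borel_measure \<rho>"
  shows "finite_measure (total_variation \<rho>)"
  by (rule finite_measureI)
    (use variation_finite[OF assms, of UNIV] in \<open>simp add: emeasure_total_variation[OF assms]\<close>)

lemma abs_le_total_variation:
  assumes "signed_borel_measure \<rho>" "A \<in> sets borel"
  shows "\<bar>\<rho> A\<bar> \<le> measure (total_variation \<rho>) A"
proof -
  interpret finite_measure "total_variation \<rho>"
    by (rule finite_measure_total_variation) fact
  show ?thesis
    using abs_le_variation[OF assms] by (simp add: emeasure_total_variation[OF assms, symmetric] emeasure_eq_measure)
qed

lemma countably_additive_ennreal:
  assumes "\<And>A. range A \<subseteq> M \<Longrightarrow> disjoint_family (A :: nat \<Rightarrow> _) \<Longrightarrow> (\<lambda>n. f (A n)) sums f (\<Union>n. A n)"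
    and "\<And>A. A \<in> M \<Longrightarrow> 0 \<le> f A"
  shows "countably_additive M (\<lambda>A. ennreal (f A))"
  unfolding countably_additive_def
proof (intro allI impI)
  fix A :: "nat \<Rightarrow> _" assume A: "range A \<subseteq> M" "disjoint_family A"
  then have "(\<lambda>n. f (A n)) sums f (\<Union>n. A n)" "\<And>n. 0 \<le> f (A n)"
    using assms by auto
  then show "(\<Sum>n. ennreal (f (A n))) = ennreal (f (\<Union>n. A n))"
    by (simp add: sums_iff suminf_ennreal2)
qed


section \<open>The Jordan decomposition\<close>

lemma total_variation_uminus: "total_variation (\<lambda>A. - \<rho> A) = total_variation \<rho>"
  by (simp add: total_variation_def)

lemma negative_part_eq: "negative_part \<rho> = positive_part (\<lambda>A. - \<rho> A)"
  by (simp add: positive_part_def negative_part_def total_variation_uminus)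

lemma signed_borel_measure_uminus:
  "signed_borel_measure \<rho> \<Longrightarrow> signed_borel_measure (\<lambda>A. - \<rho> A)"
  by (auto simp: signed_borel_measure_def intro!: sums_minus)

lemma sets_positive_part [simp, measurable_cong]: "sets (positive_part \<rho>) = sets borel"
  unfolding positive_part_def using sets.sets_measure_of_eq[of borel] by simp

lemma sets_negative_part [simp, measurable_cong]: "sets (negative_part \<rho>) = sets borel"
  unfolding negative_part_eq by (rule sets_positive_part)

lemma space_positive_part [simp]: "space (positive_part \<rho>) = UNIV"
  by (metis sets_positive_part sets_eq_imp_space_eq space_borel)

lemma space_negative_part [simp]: "space (negative_part \<rho>) = UNIV"
  unfolding negative_part_eq by (rule space_positive_part)

lemma emeasure_positive_part:
  fixes \<rho> :: "'a::topological_space set \<Rightarrow> real"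
  assumes \<rho>: "signed_borel_measure \<rho>" and A: "A \<in> sets borel"
  shows "emeasure (positive_part \<rho>) A = ennreal ((measure (total_variation \<rho>) A + \<rho> A) / 2)"
proof (rule emeasure_measure_of[OF positive_part_def])
  interpret finite_measure "total_variation \<rho>"
    by (rule finite_measure_total_variation) fact
  have "countably_additive (sets borel) (\<lambda>A. ennreal ((measure (total_variation \<rho>) A + \<rho> A) / 2))"
  proof (rule countably_additive_ennreal)
    fix A :: "nat \<Rightarrow> 'a set" assume "range A \<subseteq> sets borel" "disjoint_family A"
    then show "(\<lambda>n. (measure (total_variation \<rho>) (A n) + \<rho> (A n)) / 2) sums
        ((measure (total_variation \<rho>) (\<Union>n. A n) + \<rho> (\<Union>n. A n)) / 2)"
      by (intro sums_divide sums_add finite_measure_UNION signed_measure_sums[OF \<rho>]) auto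
  next
    fix A :: "'a set" assume "A \<in> sets borel"
    from abs_le_total_variation[OF \<rho> this]
    have "- \<rho> A \<le> measure (total_variation \<rho>) A"
      by (simp add: abs_le_iff)
    then show "0 \<le> (measure (total_variation \<rho>) A + \<rho> A) / 2"
      by simp
  qed
  then show "countably_additive (sets (positive_part \<rho>))
      (\<lambda>A. ennreal ((measure (total_variation \<rho>) A + \<rho> A) / 2))"
    by simp
qed (use A \<rho> in \<open>auto simp: positive_def\<close>)

lemma emeasure_negative_part:
  assumes "signed_borel_measure \<rho>" "A \<in> sets borel"
  shows "emeasure (negative_part \<rho>) A = ennreal ((measure (total_variation \<rho>) A - \<rho> A) / 2)"
  using emeasure_positive_part[OF signed_borel_measure_uminus[OF assms(1)] assms(2)]
  unfolding negative_part_eq total_variation_uminus by simp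

lemma finite_measure_positive_part:
  assumes "signed_borel_measure \<rho>"
  shows "finite_measure (positive_part \<rho>)"
  by (rule finite_measureI) (simp add: emeasure_positive_part[OF assms])

lemma finite_measure_negative_part:
  assumes "signed_borel_measure \<rho>"
  shows "finite_measure (negative_part \<rho>)"
  by (rule finite_measureI) (simp add: emeasure_negative_part[OF assms])

lemma emeasure_parts_sum:
  assumes \<rho>: "signed_borel_measure \<rho>" and A: "A \<in> sets borel"
  shows "emeasure (positive_part \<rho>) A + emeasure (negative_part \<rho>) A = emeasure (total_variation \<rho>) A"
proof -
  interpret finite_measure "total_variation \<rho>"
    by (rule finite_measure_total_variation) fact
  have "\<bar>\<rho> A\<bar> \<le> measure (total_variation \<rho>) A"
    by (rule abs_le_total_variation) fact+
  then have "emeasure (positive_part \<rho>) A + emeasure (negative_part \<rho>) A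
      = ennreal ((measure (total_variation \<rho>) A + \<rho> A) / 2 + (measure (total_variation \<rho>) A - \<rho> A) / 2)"
    by (simp add: emeasure_positive_part[OF \<rho> A] emeasure_negative_part[OF \<rho> A])
  also have "\<dots> = emeasure (total_variation \<rho>) A"
    unfolding emeasure_eq_measure by (rule arg_cong[where f = ennreal]) (simp add: field_simps)
  finally show ?thesis .
qed

lemma measure_parts_diff:
  assumes \<rho>: "signed_borel_measure \<rho>" and A: "A \<in> sets borel"
  shows "measure (positive_part \<rho>) A - measure (negative_part \<rho>) A = \<rho> A"
proof -
  have "\<bar>\<rho> A\<bar> \<le> measure (total_variation \<rho>) A"
    by (rule abs_le_total_variation) fact+
  then show ?thesis
    unfolding measure_def[of "positive_part \<rho>"] measure_def[of "negative_part \<rho>"]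
    by (simp add: emeasure_positive_part[OF \<rho> A] emeasure_negative_part[OF \<rho> A] field_simps)
qed

text \<open>All relations between \<open>\<rho>\<close>, its Jordan parts and its total variation have sums of two measures on
  either side. Integrals inherit them by approximation with simple functions; a null measure can
  take the place of an absent summand.\<close>

lemma nn_integral_add_measures_mono:
  fixes M1 M2 N1 N2 :: "'a measure"
  assumes s [measurable_cong]: "sets M1 = sets B" "sets M2 = sets B" "sets N1 = sets B" "sets N2 = sets B"
    and le: "\<And>A. A \<in> sets B \<Longrightarrow> emeasure M1 A + emeasure M2 A \<le> emeasure N1 A + emeasure N2 A"
    and g: "g \<in> borel_measurable B"
  shows "(\<integral>\<^sup>+x. g x \<partial>M1) + (\<integral>\<^sup>+x. g x \<partial>M2) \<le> (\<integral>\<^sup>+x. g x \<partial>N1) + (\<integral>\<^sup>+x. g x \<partial>N2)"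
  using g
proof (induction g rule: borel_measurable_induct)
  case (cong f g)
  have "(\<integral>\<^sup>+x. f x \<partial>M) = (\<integral>\<^sup>+x. g x \<partial>M)" if "sets M = sets B" for M
    using cong(3) sets_eq_imp_space_eq[OF that] by (intro nn_integral_cong) simp
  then show ?case using cong s by simp
next
  case (set A)
  then show ?case using s le by simp
next
  case (mult u c)
  note [measurable] = mult.hyps(2)
  show ?case
    using mult.IH by (simp add: nn_integral_cmult distrib_left[symmetric] mult_left_mono)
next
  case (add u v)
  note [measurable] = add.hyps(1,3)
  show ?case
    using add_mono[OF add.IH] by (simp add: nn_integral_add ac_simps)
next
  case (seq U)
  note [measurable] = seq.hyps(1)
  have conv: "(\<integral>\<^sup>+x. (SUP i. U i) x \<partial>M) = (SUP i. \<integral>\<^sup>+x. U i x \<partial>M)" if [measurable_cong]: "sets M = sets B" for M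
    unfolding SUP_apply using seq.hyps(3) by (intro nn_integral_monotone_convergence_SUP) simp_all
  have inc: "incseq (\<lambda>i. \<integral>\<^sup>+x. U i x \<partial>M)" for M
    using seq.hyps(3) by (auto simp: incseq_def le_fun_def intro!: nn_integral_mono)
  have "(SUP i. \<integral>\<^sup>+x. U i x \<partial>M1) + (SUP i. \<integral>\<^sup>+x. U i x \<partial>M2)
      = (SUP i. (\<integral>\<^sup>+x. U i x \<partial>M1) + (\<integral>\<^sup>+x. U i x \<partial>M2))"
    by (intro ennreal_SUP_add[symmetric] inc)
  also have "\<dots> \<le> (SUP i. (\<integral>\<^sup>+x. U i x \<partial>N1) + (\<integral>\<^sup>+x. U i x \<partial>N2))"
    using seq.IH by (intro SUP_mono) blast
  also have "\<dots> = (SUP i. \<integral>\<^sup>+x. U i x \<partial>N1) + (SUP i. \<integral>\<^sup>+x. U i x \<partial>N2)"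
    by (intro ennreal_SUP_add inc)
  finally show ?case
    by (simp only: conv[OF s(1)] conv[OF s(2)] conv[OF s(3)] conv[OF s(4)])
qed

lemma nn_integral_add_measures_cong:
  assumes s: "sets M1 = sets B" "sets M2 = sets B" "sets N1 = sets B" "sets N2 = sets B"
    and eq: "\<And>A. A \<in> sets B \<Longrightarrow> emeasure M1 A + emeasure M2 A = emeasure N1 A + emeasure N2 A"
    and g: "g \<in> borel_measurable B"
  shows "(\<integral>\<^sup>+x. g x \<partial>M1) + (\<integral>\<^sup>+x. g x \<partial>M2) = (\<integral>\<^sup>+x. g x \<partial>N1) + (\<integral>\<^sup>+x. g x \<partial>N2)"
proof (rule antisym)
  show "(\<integral>\<^sup>+x. g x \<partial>M1) + (\<integral>\<^sup>+x. g x \<partial>M2) \<le> (\<integral>\<^sup>+x. g x \<partial>N1) + (\<integral>\<^sup>+x. g x \<partial>N2)"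
    by (rule nn_integral_add_measures_mono[OF s eq_refl[OF eq] g])
  show "(\<integral>\<^sup>+x. g x \<partial>N1) + (\<integral>\<^sup>+x. g x \<partial>N2) \<le> (\<integral>\<^sup>+x. g x \<partial>M1) + (\<integral>\<^sup>+x. g x \<partial>M2)"
    by (rule nn_integral_add_measures_mono[OF s(3,4,1,2) eq_refl[OF eq[symmetric]] g])
qed

lemma nn_integral_le_add_measures:
  assumes "sets M = sets B" "sets N1 = sets B" "sets N2 = sets B"
    and "\<And>A. A \<in> sets B \<Longrightarrow> emeasure M A \<le> emeasure N1 A + emeasure N2 A"
    and "g \<in> borel_measurable B"
  shows "(\<integral>\<^sup>+x. g x \<partial>M) \<le> (\<integral>\<^sup>+x. g x \<partial>N1) + (\<integral>\<^sup>+x. g x \<partial>N2)"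
  using nn_integral_add_measures_mono[of M B "null_measure B" N1 N2 g] assms by simp

lemma integrable_le_add_measures:
  fixes g :: "'a \<Rightarrow> real"
  assumes s: "sets M = sets B" "sets N1 = sets B" "sets N2 = sets B"
    and le: "\<And>A. A \<in> sets B \<Longrightarrow> emeasure M A \<le> emeasure N1 A + emeasure N2 A"
    and g: "integrable N1 g" "integrable N2 g"
  shows "integrable M g"
proof -
  have gB: "g \<in> borel_measurable B"
    using borel_measurable_integrable[OF g(1)] measurable_cong_sets[OF s(2) refl] by blast
  then have m: "g \<in> borel_measurable M"
    using measurable_cong_sets[OF s(1) refl] by blast
  have "(\<integral>\<^sup>+x. ennreal (norm (g x)) \<partial>M)
      \<le> (\<integral>\<^sup>+x. ennreal (norm (g x)) \<partial>N1) + (\<integral>\<^sup>+x. ennreal (norm (g x)) \<partial>N2)"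
    using gB by (intro nn_integral_le_add_measures[OF s le]) auto
  also have "\<dots> < \<infinity>"
    using g by (simp add: integrable_iff_bounded)
  finally show ?thesis
    using m by (simp add: integrable_iff_bounded)
qed

lemma integral_add_measures_cong:
  fixes g :: "'a \<Rightarrow> real"
  assumes s: "sets M1 = sets B" "sets M2 = sets B" "sets N1 = sets B" "sets N2 = sets B"
    and eq: "\<And>A. A \<in> sets B \<Longrightarrow> emeasure M1 A + emeasure M2 A = emeasure N1 A + emeasure N2 A"
    and g: "integrable M1 g" "integrable M2 g" "integrable N1 g" "integrable N2 g"
  shows "(\<integral>x. g x \<partial>M1) + (\<integral>x. g x \<partial>M2) = (\<integral>x. g x \<partial>N1) + (\<integral>x. g x \<partial>N2)"
proof -
  have gB: "g \<in> borel_measurable B"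
    using borel_measurable_integrable[OF g(1)] measurable_cong_sets[OF s(1) refl] by blast
  have half: "enn2real (\<integral>\<^sup>+x. ennreal (h x) \<partial>M1) + enn2real (\<integral>\<^sup>+x. ennreal (h x) \<partial>M2)
      = enn2real (\<integral>\<^sup>+x. ennreal (h x) \<partial>N1) + enn2real (\<integral>\<^sup>+x. ennreal (h x) \<partial>N2)"
    if h: "h \<in> borel_measurable B"
      and fin: "\<And>M. M \<in> {M1, M2, N1, N2} \<Longrightarrow> (\<integral>\<^sup>+x. ennreal (h x) \<partial>M) \<noteq> \<infinity>" for h
  proof -
    have "(\<integral>\<^sup>+x. ennreal (h x) \<partial>M1) + (\<integral>\<^sup>+x. ennreal (h x) \<partial>M2)
        = (\<integral>\<^sup>+x. ennreal (h x) \<partial>N1) + (\<integral>\<^sup>+x. ennreal (h x) \<partial>N2)"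
      using h by (intro nn_integral_add_measures_cong[OF s eq]) auto
    then show ?thesis
      using fin by (metis enn2real_plus infinity_ennreal_def insertCI top.not_eq_extremum)
  qed
  have "enn2real (\<integral>\<^sup>+x. ennreal (g x) \<partial>M1) + enn2real (\<integral>\<^sup>+x. ennreal (g x) \<partial>M2)
      = enn2real (\<integral>\<^sup>+x. ennreal (g x) \<partial>N1) + enn2real (\<integral>\<^sup>+x. ennreal (g x) \<partial>N2)"
    using g gB by (intro half) (auto simp: real_integrable_def)
  moreover have "enn2real (\<integral>\<^sup>+x. ennreal (- g x) \<partial>M1) + enn2real (\<integral>\<^sup>+x. ennreal (- g x) \<partial>M2)
      = enn2real (\<integral>\<^sup>+x. ennreal (- g x) \<partial>N1) + enn2real (\<integral>\<^sup>+x. ennreal (- g x) \<partial>N2)"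
    using g gB by (intro half) (auto simp: real_integrable_def)
  ultimately show ?thesis
    using g by (simp add: real_lebesgue_integral_def)
qed

lemma integrable_parts:
  fixes g :: "'a::topological_space \<Rightarrow> real"
  assumes \<rho>: "signed_borel_measure \<rho>" and g: "integrable (total_variation \<rho>) g"
  shows "integrable (positive_part \<rho>) g" "integrable (negative_part \<rho>) g"
proof -
  have "emeasure M A \<le> emeasure (total_variation \<rho>) A + emeasure (null_measure borel) A"
    if "A \<in> sets borel" "M \<in> {positive_part \<rho>, negative_part \<rho>}" for A M
    using that by (auto simp: emeasure_parts_sum[OF \<rho>, symmetric] add_increasing add_increasing2)
  moreover have "integrable (null_measure borel) g"
    using borel_measurable_integrable[OF g] by (simp add: integrable_iff_bounded)
  ultimately show "integrable (positive_part \<rho>) g" "integrable (negative_part \<rho>) g"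
    using g by (auto intro: integrable_le_add_measures[of _ borel "total_variation \<rho>" "null_measure borel"])
qed

lemma integral_parts_sum:
  fixes g :: "'a::topological_space \<Rightarrow> real"
  assumes \<rho>: "signed_borel_measure \<rho>" and g: "integrable (total_variation \<rho>) g"
  shows "(\<integral>z. g z \<partial>positive_part \<rho>) + (\<integral>z. g z \<partial>negative_part \<rho>) = (\<integral>z. g z \<partial>total_variation \<rho>)"
proof -
  have n: "integrable (null_measure borel) g"
    using borel_measurable_integrable[OF g] by (simp add: integrable_iff_bounded)
  have "(\<integral>z. g z \<partial>positive_part \<rho>) + (\<integral>z. g z \<partial>negative_part \<rho>)
      = (\<integral>z. g z \<partial>total_variation \<rho>) + (\<integral>z. g z \<partial>null_measure borel)"
    using integrable_parts[OF \<rho> g] g n emeasure_parts_sum[OF \<rho>]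
    by (intro integral_add_measures_cong[where B = borel]) auto
  moreover have "(\<integral>z. g z \<partial>null_measure borel) = 0"
    using n by (simp add: real_lebesgue_integral_def)
  ultimately show ?thesis by simp
qed

subsection \<open>Signed measures presented as differences\<close>

context
  fixes P N :: "'a::topological_space measure" and \<rho> :: "'a set \<Rightarrow> real"
  assumes finP: "finite_measure P" and finN: "finite_measure N"
    and sP [simp, measurable_cong]: "sets P = sets borel"
    and sN [simp, measurable_cong]: "sets N = sets borel"
    and \<rho>_def: "\<rho> = (\<lambda>A. measure P A - measure N A)"
begin

interpretation P: finite_measure P by (rule finP)
interpretation N: finite_measure N by (rule finN)

lemma signed_borel_measure_diff: "signed_borel_measure \<rho>"
  unfolding signed_borel_measure_def \<rho>_def
proof (intro conjI allI impI)
  fix A :: "nat \<Rightarrow> 'a set" assume "range A \<subseteq> sets borel" "disjoint_family A"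
  then show "(\<lambda>n. measure P (A n) - measure N (A n)) sums
      (measure P (\<Union>n. A n) - measure N (\<Union>n. A n))"
    by (intro sums_diff P.finite_measure_UNION N.finite_measure_UNION) simp_all
qed simp

lemma total_variation_diff_le:
  assumes A: "A \<in> sets borel"
  shows "emeasure (total_variation \<rho>) A \<le> emeasure P A + emeasure N A"
  unfolding emeasure_total_variation[OF signed_borel_measure_diff A]
proof (rule variation_leI)
  fix S assume S: "finite S" "partition_on A S" "S \<subseteq> sets borel"
  have "(\<Sum>B\<in>S. ennreal \<bar>\<rho> B\<bar>) \<le> (\<Sum>B\<in>S. emeasure P B + emeasure N B)"
    by (intro sum_mono) (simp add: \<rho>_def P.emeasure_eq_measure N.emeasure_eq_measure abs_le_iff
        ennreal_leI add_increasing add_increasing2 flip: ennreal_plus)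
  also have "\<dots> = emeasure P (\<Union>S) + emeasure N (\<Union>S)"
  proof -
    have "disjoint_family_on (\<lambda>B. B) S"
      using S(2) by (auto simp: partition_on_def disjoint_family_on_def dest: disjointD)
    then show ?thesis
      using S sum_emeasure[of "\<lambda>B. B" S P] sum_emeasure[of "\<lambda>B. B" S N]
      by (simp add: sum.distrib)
  qed
  also have "\<Union>S = A"
    using S(2) by (simp add: partition_on_def)
  finally show "(\<Sum>B\<in>S. ennreal \<bar>\<rho> B\<bar>) \<le> emeasure P A + emeasure N A" .
qed

lemma integrable_total_variation_diff:
  fixes g :: "'a \<Rightarrow> real"
  assumes "integrable P g" "integrable N g"
  shows "integrable (total_variation \<rho>) g"
  by (rule integrable_le_add_measures[OF sets_total_variation sP sN total_variation_diff_le assms])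

lemma integral_total_variation_diff_le:
  fixes g :: "'a \<Rightarrow> real"
  assumes g: "integrable P g" "integrable N g" and nonneg: "\<And>z. 0 \<le> g z"
  shows "(\<integral>z. g z \<partial>total_variation \<rho>) \<le> (\<integral>z. g z \<partial>P) + (\<integral>z. g z \<partial>N)"
proof -
  have "(\<integral>\<^sup>+z. ennreal (g z) \<partial>total_variation \<rho>) \<le> (\<integral>\<^sup>+z. ennreal (g z) \<partial>P) + (\<integral>\<^sup>+z. ennreal (g z) \<partial>N)"
    using borel_measurable_integrable[OF g(1)] total_variation_diff_le
    by (intro nn_integral_le_add_measures[of _ borel]) auto
  also have "\<dots> = ennreal ((\<integral>z. g z \<partial>P) + (\<integral>z. g z \<partial>N))"
    using g nonneg by (simp add: nn_integral_eq_integral integral_nonneg)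
  finally show ?thesis
    using integrable_total_variation_diff[OF g] g nonneg
    by (simp add: nn_integral_eq_integral integral_nonneg ennreal_le_iff add_nonneg_nonneg
        del: ennreal_plus)
qed

text \<open>The decomposition \<open>P - N\<close> need not be the Jordan decomposition, but the two differ by the
  same measure in both parts: \<open>\<rho>\<^sup>+ + N = P + \<rho>\<^sup>-\<close>.\<close>

lemma has_signed_integral_diff:
  fixes g :: "'a \<Rightarrow> real"
  assumes g: "integrable P g" "integrable N g"
  shows "has_signed_integral g ((\<integral>z. g z \<partial>P) - (\<integral>z. g z \<partial>N)) \<rho>"
proof -
  note \<rho> = signed_borel_measure_diff
  note tv = integrable_total_variation_diff[OF g]
  interpret pos: finite_measure "positive_part \<rho>" by (rule finite_measure_positive_part[OF \<rho>])
  interpret neg: finite_measure "negative_part \<rho>" by (rule finite_measure_negative_part[OF \<rho>])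
  have "emeasure (positive_part \<rho>) A + emeasure N A = emeasure P A + emeasure (negative_part \<rho>) A"
    if "A \<in> sets borel" for A
  proof -
    have "measure (positive_part \<rho>) A + measure N A = measure P A + measure (negative_part \<rho>) A"
      using measure_parts_diff[OF \<rho> that] by (simp add: \<rho>_def)
    then show ?thesis
      by (simp add: pos.emeasure_eq_measure neg.emeasure_eq_measure P.emeasure_eq_measure
          N.emeasure_eq_measure flip: ennreal_plus)
  qed
  then have "(\<integral>z. g z \<partial>positive_part \<rho>) + (\<integral>z. g z \<partial>N) = (\<integral>z. g z \<partial>P) + (\<integral>z. g z \<partial>negative_part \<rho>)"
    using integrable_parts[OF \<rho> tv] g by (intro integral_add_measures_cong[of _ borel]) auto
  then show ?thesis
    unfolding has_signed_integral_def using tv by simp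
qed

end


section \<open>Weights and homogeneity\<close>

abbreviation weight :: "(real ^ 'd) \<times> real \<Rightarrow> real" where
  "weight z \<equiv> norm_l1 (fst z) + \<bar>snd z\<bar>"

lemma norm_l1_nonneg: "0 \<le> norm_l1 w"
  by (simp add: norm_l1_def sum_nonneg)

lemma norm_l1_eq_0: "norm_l1 w = 0 \<longleftrightarrow> w = 0"
  by (simp add: norm_l1_def sum_nonneg_eq_0_iff vec_eq_iff)

lemma norm_l1_scaleR: "norm_l1 (c *\<^sub>R w) = \<bar>c\<bar> * norm_l1 w"
  by (simp add: norm_l1_def abs_mult sum_distrib_left)

lemma weight_nonneg: "0 \<le> weight z"
  by (simp add: norm_l1_nonneg)

lemma weight_eq_0_iff: "weight z = 0 \<longleftrightarrow> z = 0"
  using norm_l1_nonneg[of "fst z"] by (auto simp: prod_eq_iff norm_l1_eq_0 add_nonneg_eq_0_iff)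

lemma weight_scaleR: "weight (c *\<^sub>R z) = \<bar>c\<bar> * weight z"
  by (simp add: norm_l1_scaleR abs_mult distrib_left)

lemma borel_measurable_norm_l1 [measurable]: "norm_l1 \<in> borel_measurable borel"
  unfolding norm_l1_def by (intro borel_measurable_continuous_onI continuous_intros)

lemma borel_measurable_relu_pow [measurable]: "relu_pow s \<in> borel_measurable borel"
  unfolding relu_pow_def by measurable

lemma borel_measurable_weight [measurable]:
  "weight \<in> borel_measurable (borel :: ((real ^ 'd) \<times> real) measure)"
  unfolding borel_prod[symmetric] by measurable

lemma borel_measurable_neuron [measurable]:
  "(\<lambda>(w, b). relu_pow s (w \<bullet> x + b)) \<in> borel_measurable (borel :: ((real ^ 'd) \<times> real) measure)"
  unfolding borel_prod[symmetric] by measurable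

lemma relu_pow_nonneg: "0 \<le> relu_pow s x"
  by (simp add: relu_pow_def)

lemma relu_pow_0 [simp]: "relu_pow s 0 = 0"
  by (simp add: relu_pow_def)

lemma relu_pow_1 [simp]: "relu_pow s 1 = 1"
  by (simp add: relu_pow_def)

lemma relu_pow_mult: "0 \<le> c \<Longrightarrow> relu_pow s (c * x) = relu_pow s c * relu_pow s x"
  by (cases "0 \<le> x") (simp_all add: relu_pow_def powr_mult mult_nonneg_nonpos max_def not_le
      mult_le_0_iff zero_le_mult_iff)

lemma relu_pow_le_one_plus:
  assumes "0 < s" "s \<le> t" "0 \<le> x"
  shows "relu_pow s x \<le> 1 + relu_pow t x"
proof (cases "x \<le> 1")
  case True
  then have "x powr s \<le> 1"
    using assms by (intro powr_le1) auto
  then show ?thesis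
    using assms powr_ge_zero[of x t] by (simp add: relu_pow_def add_increasing2)
next
  case False
  then have "x powr s \<le> x powr t"
    using assms by (intro powr_mono) auto
  then show ?thesis
    using assms by (simp add: relu_pow_def)
qed

section \<open>Projection to the unit sphere of the weight\<close>

text \<open>At the origin the division by zero yields \<open>normalize 0 = 0\<close>, which has weight 0 instead of 1.
  This does no harm because all densities below vanish there.\<close>

definition normalize :: "(real ^ 'd) \<times> real \<Rightarrow> (real ^ 'd) \<times> real" where
  "normalize z = (1 / weight z) *\<^sub>R z"

text \<open>Moving a neuron \<open>z\<close> to \<open>z / r\<close>, \<open>r\<close> its weight, divides its output by \<open>r\<^sup>s\<close>;
  multiplying the mass by \<open>r\<^sup>s\<close> compensates for this.\<close>

definition sphere_projection ::
    "real \<Rightarrow> ((real ^ 'd) \<times> real) measure \<Rightarrow> ((real ^ 'd) \<times> real) measure" where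
  "sphere_projection s M = distr (density M (\<lambda>z. ennreal (relu_pow s (weight z)))) borel normalize"

lemma borel_measurable_normalize [measurable]:
  "(normalize :: (real ^ 'd) \<times> real \<Rightarrow> _) \<in> borel_measurable borel"
  unfolding normalize_def by measurable

lemma sets_sphere_projection [simp, measurable_cong]: "sets (sphere_projection s M) = sets borel"
  by (simp add: sphere_projection_def)

lemma weight_normalize: "z \<noteq> 0 \<Longrightarrow> weight (normalize z) = 1"
  using weight_nonneg[of z] weight_eq_0_iff[of z] by (simp only: normalize_def weight_scaleR) simp

lemma relu_pow_normalize:
  "relu_pow s (weight z) * (case normalize z of (w, b) \<Rightarrow> relu_pow s (w \<bullet> x + b))
     = (case z of (w, b) \<Rightarrow> relu_pow s (w \<bullet> x + b))"
proof (cases "z = 0")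
  case True
  then show ?thesis by (simp add: zero_prod_def norm_l1_def)
next
  case False
  then have w: "weight z > 0"
    using weight_nonneg[of z] weight_eq_0_iff[of z] by linarith
  obtain a b where z: "z = (a, b)" by fastforce
  have "relu_pow s (weight z) * relu_pow s ((1 / weight z) * (a \<bullet> x + b)) = relu_pow s (a \<bullet> x + b)"
    using w by (subst relu_pow_mult[symmetric]) (auto simp: z)
  then show ?thesis
    by (simp add: normalize_def z distrib_left inner_scaleR_left add_divide_distrib)
qed

context
  fixes M :: "((real ^ 'd) \<times> real) measure" and s :: real
  assumes sM [simp, measurable_cong]: "sets M = sets borel"
    and int: "integrable M (\<lambda>z. relu_pow s (weight z))"
begin

text \<open>The total mass of the projection is the Barron integral of the original measure.\<close>

lemma finite_measure_sphere_projection: "finite_measure (sphere_projection s M)"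
proof (rule finite_measureI)
  have "emeasure (sphere_projection s M) (space (sphere_projection s M))
      = (\<integral>\<^sup>+z. ennreal (relu_pow s (weight z)) \<partial>M)"
    unfolding sphere_projection_def
    by (subst emeasure_distr)
      (auto simp: emeasure_density sets_eq_imp_space_eq[OF sM] intro!: nn_integral_cong)
  also have "\<dots> < \<infinity>"
    using int by (simp add: integrable_iff_bounded relu_pow_nonneg)
  finally show "emeasure (sphere_projection s M) (space (sphere_projection s M)) \<noteq> \<infinity>"
    by simp
qed

lemma integrable_sphere_projection_iff:
  fixes g :: "_ \<Rightarrow> real"
  assumes [measurable]: "g \<in> borel_measurable borel"
  shows "integrable (sphere_projection s M) g
    \<longleftrightarrow> integrable M (\<lambda>z. relu_pow s (weight z) * g (normalize z))"
  unfolding sphere_projection_def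
  by (subst integrable_distr_eq, measurable, subst integrable_density)
    (auto simp: relu_pow_nonneg)

lemma integral_sphere_projection:
  fixes g :: "_ \<Rightarrow> real"
  assumes [measurable]: "g \<in> borel_measurable borel"
  shows "(\<integral>z. g z \<partial>sphere_projection s M) = (\<integral>z. relu_pow s (weight z) * g (normalize z) \<partial>M)"
  unfolding sphere_projection_def
  by (subst integral_distr, measurable, subst integral_density)
    (auto simp: relu_pow_nonneg)

end

section \<open>The two Barron spaces\<close>

text \<open>The weights in both definitions match on the pair \<open>(w, b)\<close>; the forms below let the
  simplifier see them as functions of one variable.\<close>

lemma barron_representations_alt:
  "barron_representations s \<Omega> f = {\<rho>. signed_borel_measure \<rho> \<and>
     (AE x in lebesgue_on \<Omega>. has_signed_integral (\<lambda>(w, b). relu_pow s (w \<bullet> x + b)) (f x) \<rho>) \<and>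
     integrable (total_variation \<rho>) (\<lambda>z. relu_pow s (weight z))}"
  by (simp add: barron_representations_def case_prod_beta')

lemma gen_barron_representations_alt:
  "gen_barron_representations \<sigma> \<phi> \<Omega> f = {\<rho>. signed_borel_measure \<rho> \<and>
     (AE x in lebesgue_on \<Omega>. has_signed_integral (\<lambda>(w, b). \<sigma> (w \<bullet> x + b)) (f x) \<rho>) \<and>
     integrable (total_variation \<rho>) (\<lambda>z. \<phi> (weight z))}"
  by (simp add: gen_barron_representations_def case_prod_beta')

text \<open>Project the Jordan parts of \<open>\<rho>\<close> to the unit sphere and take the difference. By homogeneity it
  represents the same function. On the sphere \<open>\<phi> = 1 + 1 = 2\<close>, and the masses of the
  two projections add up to the Barron integral of \<open>\<rho>\<close>. The projections may overlap, so that
  their difference can have a smaller total variation than their sum: hence only an inequality.\<close>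

lemma gen_barron_representation_of_barron:
  fixes \<Omega> :: "(real ^ 'd) set"
  assumes \<rho>: "\<rho> \<in> barron_representations s \<Omega> f"
  obtains \<nu> where "\<nu> \<in> gen_barron_representations (relu_pow s) (\<lambda>x. 1 + relu_pow t x) \<Omega> f"
    and "(\<integral>z. 1 + relu_pow t (weight z) \<partial>total_variation \<nu>)
      \<le> 2 * (\<integral>z. relu_pow s (weight z) \<partial>total_variation \<rho>)"
proof -
  have sig: "signed_borel_measure \<rho>"
    and ae: "AE x in lebesgue_on \<Omega>. has_signed_integral (\<lambda>(w, b). relu_pow s (w \<bullet> x + b)) (f x) \<rho>"
    and int: "integrable (total_variation \<rho>) (\<lambda>z. relu_pow s (weight z))"
    using \<rho> by (auto simp: barron_representations_alt)
  define P where "P = sphere_projection s (positive_part \<rho>)"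
  define N where "N = sphere_projection s (negative_part \<rho>)"
  define \<nu> where "\<nu> = (\<lambda>A. measure P A - measure N A)"
  note ints = integrable_parts[OF sig int]
  have sets: "sets P = sets borel" "sets N = sets borel"
    by (simp_all add: P_def N_def)
  have fin: "finite_measure P" "finite_measure N"
    unfolding P_def N_def by (intro finite_measure_sphere_projection ints; simp)+
  note diff = fin sets \<nu>_def
  have intP: "integrable P g \<longleftrightarrow> integrable (positive_part \<rho>) (\<lambda>z. relu_pow s (weight z) * g (normalize z))"
    "(\<integral>z. g z \<partial>P) = (\<integral>z. relu_pow s (weight z) * g (normalize z) \<partial>positive_part \<rho>)"
    if "g \<in> borel_measurable borel" for g :: "_ \<Rightarrow> real"
    unfolding P_def using that ints
    by (simp_all add: integrable_sphere_projection_iff integral_sphere_projection)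
  have intN: "integrable N g \<longleftrightarrow> integrable (negative_part \<rho>) (\<lambda>z. relu_pow s (weight z) * g (normalize z))"
    "(\<integral>z. g z \<partial>N) = (\<integral>z. relu_pow s (weight z) * g (normalize z) \<partial>negative_part \<rho>)"
    if "g \<in> borel_measurable borel" for g :: "_ \<Rightarrow> real"
    unfolding N_def using that ints
    by (simp_all add: integrable_sphere_projection_iff integral_sphere_projection)
  have rep: "has_signed_integral (\<lambda>(w, b). relu_pow s (w \<bullet> x + b)) v \<nu>"
    if "has_signed_integral (\<lambda>(w, b). relu_pow s (w \<bullet> x + b)) v \<rho>" for x v
  proof -
    let ?g = "\<lambda>(w, b). relu_pow s (w \<bullet> x + b)"
    have g: "integrable (total_variation \<rho>) ?g"
      and v: "v = (\<integral>z. ?g z \<partial>positive_part \<rho>) - (\<integral>z. ?g z \<partial>negative_part \<rho>)"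
      using that by (auto simp: has_signed_integral_def)
    have "integrable P ?g" "integrable N ?g"
      using integrable_parts[OF sig g] by (simp_all add: intP intN relu_pow_normalize)
    then show ?thesis
      using has_signed_integral_diff[OF diff, of ?g] by (simp add: v intP intN relu_pow_normalize)
  qed
  let ?\<phi> = "\<lambda>z. 1 + relu_pow t (weight z)"
  have \<phi>: "relu_pow s (weight z) * ?\<phi> (normalize z) = 2 * relu_pow s (weight z)" for z :: "(real ^ 'd) \<times> real"
  proof (cases "z = 0")
    case True
    then have "weight z = 0" by (simp only: weight_eq_0_iff)
    then show ?thesis by simp
  qed (simp add: weight_normalize)
  have \<phi>P: "integrable P ?\<phi>" "(\<integral>z. ?\<phi> z \<partial>P) = 2 * (\<integral>z. relu_pow s (weight z) \<partial>positive_part \<rho>)"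
    using ints by (subst intP; simp add: \<phi>)+
  have \<phi>N: "integrable N ?\<phi>" "(\<integral>z. ?\<phi> z \<partial>N) = 2 * (\<integral>z. relu_pow s (weight z) \<partial>negative_part \<rho>)"
    using ints by (subst intN; simp add: \<phi>)+
  show thesis
  proof
    show "\<nu> \<in> gen_barron_representations (relu_pow s) (\<lambda>x. 1 + relu_pow t x) \<Omega> f"
      unfolding gen_barron_representations_alt
      using signed_borel_measure_diff[OF diff] ae rep integrable_total_variation_diff[OF diff \<phi>P(1) \<phi>N(1)]
      by auto
    have "(\<integral>z. ?\<phi> z \<partial>total_variation \<nu>) \<le> (\<integral>z. ?\<phi> z \<partial>P) + (\<integral>z. ?\<phi> z \<partial>N)"
      by (rule integral_total_variation_diff_le[OF diff \<phi>P(1) \<phi>N(1)]) (simp add: relu_pow_nonneg)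
    also have "\<dots> = 2 * (\<integral>z. relu_pow s (weight z) \<partial>total_variation \<rho>)"
      unfolding \<phi>P \<phi>N integral_parts_sum[OF sig int, symmetric] by simp
    finally show "(\<integral>z. ?\<phi> z \<partial>total_variation \<nu>)
      \<le> 2 * (\<integral>z. relu_pow s (weight z) \<partial>total_variation \<rho>)" .
  qed
qed

lemma barron_representation_of_gen_barron:
  fixes \<Omega> :: "(real ^ 'd) set"
  assumes st: "0 < s" "s \<le> t"
    and \<rho>: "\<rho> \<in> gen_barron_representations (relu_pow s) (\<lambda>x. 1 + relu_pow t x) \<Omega> f"
  shows "\<rho> \<in> barron_representations s \<Omega> f"
    and "(\<integral>z. relu_pow s (weight z) \<partial>total_variation \<rho>)
      \<le> (\<integral>z. 1 + relu_pow t (weight z) \<partial>total_variation \<rho>)"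
proof -
  let ?\<phi> = "\<lambda>z. 1 + relu_pow t (weight z)"
  have \<phi>: "integrable (total_variation \<rho>) ?\<phi>"
    using \<rho> by (simp add: gen_barron_representations_alt)
  have le: "relu_pow s (weight z) \<le> ?\<phi> z" for z :: "(real ^ 'd) \<times> real"
    by (intro relu_pow_le_one_plus st weight_nonneg)
  have int: "integrable (total_variation \<rho>) (\<lambda>z. relu_pow s (weight z))"
  proof (rule Bochner_Integration.integrable_bound[OF \<phi>])
    show "(\<lambda>z. relu_pow s (weight z)) \<in> borel_measurable (total_variation \<rho>)"
      by measurable
    show "AE z in total_variation \<rho>. norm (relu_pow s (weight z)) \<le> norm (?\<phi> z)"
      using le by (simp add: relu_pow_nonneg)
  qed
  then show "\<rho> \<in> barron_representations s \<Omega> f"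
    using \<rho> by (simp add: gen_barron_representations_alt barron_representations_alt)
  show "(\<integral>z. relu_pow s (weight z) \<partial>total_variation \<rho>) \<le> (\<integral>z. ?\<phi> z \<partial>total_variation \<rho>)"
    using int \<phi> le by (intro integral_mono)
qed

text \<open>The representing integral depends measurably on \<open>x\<close> by Fubini's theorem, and almost-everywhere
  equality preserves Lebesgue measurability.\<close>

lemma borel_measurable_barron:
  fixes f :: "real ^ 'd \<Rightarrow> real"
  assumes \<Omega>: "\<Omega> \<in> sets lebesgue" and f: "f \<in> barron_space s \<Omega>"
  shows "f \<in> borel_measurable (lebesgue_on \<Omega>)"
proof -
  obtain \<rho> where sig: "signed_borel_measure \<rho>"
    and ae: "AE x in lebesgue_on \<Omega>. has_signed_integral (\<lambda>(w, b). relu_pow s (w \<bullet> x + b)) (f x) \<rho>"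
    using f by (auto simp: barron_space_def barron_representations_def)
  define F where "F x = (\<integral>(w, b). relu_pow s (w \<bullet> x + b) \<partial>positive_part \<rho>)
      - (\<integral>(w, b). relu_pow s (w \<bullet> x + b) \<partial>negative_part \<rho>)" for x
  have joint: "(\<lambda>(x, w, b). relu_pow s (w \<bullet> x + b))
      \<in> borel_measurable (borel \<Otimes>\<^sub>M (borel :: ((real ^ 'd) \<times> real) measure))"
    unfolding borel_prod[symmetric] by measurable
  have meas: "(\<lambda>x. \<integral>(w, b). relu_pow s (w \<bullet> x + b) \<partial>M) \<in> borel_measurable borel"
    if "finite_measure M" and [measurable_cong]: "sets M = sets borel" for M :: "((real ^ 'd) \<times> real) measure"
  proof -
    interpret finite_measure M by fact
    show ?thesis
      by (rule borel_measurable_lebesgue_integral)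
        (use joint in \<open>simp add: split_beta' cong: measurable_cong_sets\<close>)
  qed
  have "F \<in> borel_measurable borel"
    unfolding F_def using finite_measure_positive_part[OF sig] finite_measure_negative_part[OF sig]
    by (intro borel_measurable_diff meas) auto
  then have "F \<in> borel_measurable (lebesgue_on \<Omega>)"
    by (intro measurable_restrict_space1 measurable_completion) simp
  then have 1: "(\<lambda>x. if x \<in> \<Omega> then F x else 0) \<in> borel_measurable lebesgue"
    using borel_measurable_if[OF \<Omega>] by blast
  have "AE x in lebesgue_on \<Omega>. F x = f x"
    using ae by eventually_elim (simp add: has_signed_integral_def F_def)
  then have "AE x in lebesgue. (if x \<in> \<Omega> then F x else 0) = (if x \<in> \<Omega> then f x else 0)"
    using \<Omega> by (auto simp: AE_restrict_space_iff elim: eventually_mono)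
  then have "(\<lambda>x. if x \<in> \<Omega> then f x else 0) \<in> borel_measurable lebesgue"
    by (rule borel_measurable_AE[OF 1])
  then show ?thesis
    using borel_measurable_if[OF \<Omega>] by blast
qed

lemma open_unit_cube_eq_box: "open_unit_cube = box 0 (1 :: real ^ 'd)"
  by (auto simp: open_unit_cube_def box_def Basis_vec_def inner_axis)

theorem proposition2p5:
  fixes s t :: real
  assumes "s > 0" and "t \<ge> s"
  shows "gen_barron_space (relu_pow s) (\<lambda>x. 1 + relu_pow t x) open_unit_cube
           = (barron_space s open_unit_cube :: (real ^ 'd \<Rightarrow> real) set) \<and>
         (\<forall>f \<in> (barron_space s open_unit_cube :: (real ^ 'd \<Rightarrow> real) set).
            1 / 2 * gen_barron_norm (relu_pow s) (\<lambda>x. 1 + relu_pow t x) open_unit_cube f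
              \<le> barron_norm s open_unit_cube f \<and>
            barron_norm s open_unit_cube f
              \<le> gen_barron_norm (relu_pow s) (\<lambda>x. 1 + relu_pow t x) open_unit_cube f)"
proof (intro conjI ballI)
  let ?\<phi> = "\<lambda>x. 1 + relu_pow t x"
  let ?\<Omega> = "open_unit_cube :: (real ^ 'd) set"
  have \<Omega>: "?\<Omega> \<in> sets lebesgue"
    by (simp add: open_unit_cube_eq_box)
  show "gen_barron_space (relu_pow s) ?\<phi> ?\<Omega> = barron_space s ?\<Omega>"
  proof (intro equalityI subsetI)
    fix f assume "f \<in> gen_barron_space (relu_pow s) ?\<phi> ?\<Omega>"
    then show "f \<in> barron_space s ?\<Omega>"
      using barron_representation_of_gen_barron(1)[OF assms]
      by (auto simp: gen_barron_space_def barron_space_def)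
  next
    fix f assume f: "f \<in> barron_space s ?\<Omega>"
    then obtain \<rho> where "\<rho> \<in> barron_representations s ?\<Omega> f"
      by (auto simp: barron_space_def)
    then show "f \<in> gen_barron_space (relu_pow s) ?\<phi> ?\<Omega>"
      using borel_measurable_barron[OF \<Omega> f]
      by (elim gen_barron_representation_of_barron[where t = t]) (auto simp: gen_barron_space_def)
  qed
  fix f assume f: "f \<in> barron_space s ?\<Omega>"
  let ?B = "barron_representations s ?\<Omega> f"
  let ?G = "gen_barron_representations (relu_pow s) ?\<phi> ?\<Omega> f"
  let ?b = "\<lambda>\<rho>. \<integral>z. relu_pow s (weight z) \<partial>total_variation \<rho>"
  let ?g = "\<lambda>\<rho>. \<integral>z. ?\<phi> (weight z) \<partial>total_variation \<rho>"
  have bn: "barron_norm s ?\<Omega> f = (INF \<rho>\<in>?B. ?b \<rho>)"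
    and gn: "gen_barron_norm (relu_pow s) ?\<phi> ?\<Omega> f = (INF \<rho>\<in>?G. ?g \<rho>)"
    by (simp_all add: barron_norm_def gen_barron_norm_def case_prod_beta')
  have B: "?B \<noteq> {}"
    using f by (simp add: barron_space_def)
  then have G: "?G \<noteq> {}"
    using gen_barron_representation_of_barron[where t = t] by (metis ex_in_conv)
  have bddB: "bdd_below (?b ` ?B)"
    by (rule bdd_belowI2[where m = 0]) (simp add: integral_nonneg relu_pow_nonneg)
  have bddG: "bdd_below (?g ` ?G)"
    by (rule bdd_belowI2[where m = 0]) (simp add: integral_nonneg relu_pow_nonneg)
  show "1 / 2 * gen_barron_norm (relu_pow s) ?\<phi> ?\<Omega> f \<le> barron_norm s ?\<Omega> f"
    unfolding bn
  proof (rule cINF_greatest[OF B])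
    fix \<rho> assume "\<rho> \<in> ?B"
    then obtain \<nu> where \<nu>: "\<nu> \<in> ?G" "?g \<nu> \<le> 2 * ?b \<rho>"
      by (rule gen_barron_representation_of_barron)
    then show "1 / 2 * gen_barron_norm (relu_pow s) ?\<phi> ?\<Omega> f \<le> ?b \<rho>"
      using cINF_lower[OF bddG \<nu>(1)] unfolding gn by linarith
  qed
  show "barron_norm s ?\<Omega> f \<le> gen_barron_norm (relu_pow s) ?\<phi> ?\<Omega> f"
    unfolding gn
  proof (rule cINF_greatest[OF G])
    fix \<rho> assume "\<rho> \<in> ?G"
    note \<rho> = barron_representation_of_gen_barron[OF assms this]
    show "barron_norm s ?\<Omega> f \<le> ?g \<rho>"
      using cINF_lower[OF bddB \<rho>(1)] \<rho>(2) unfolding bn by linarith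
  qed
qed

end
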